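(* Let $G=(V,E)$ be a connected finite graph with weight $\omega$ and measure $\mu$. Let $h:V\to\mathbb{R}$ and $c\in\mathbb{R}$ satisfy: 1) if $c>0$, then $h(x)>0$ for some $x\in V$; 2) if $c=0$, then $h$ changes sign (i.e. $h$ is positive at some vertex and negative at some vertex) and $\int_V h\,d\mu<0$; 3) if $c<0$, then $h(x)<0$ for some $x\in V$. Then there exists a constant $C$ depending only on $h,c,G,\omega$ and $\mu$ such that every solution $u:V\to\mathbb{R}$ of the Kazdan-Warner equation $$-\Delta u(x)=h(x)e^{u(x)}-c,\quad x\in V,$$ satisfies $\max_{x\in V}|u(x)|\le C$.
   Context: A connected finite graph $G=(V,E)$ has finite vertex set $V$ and edge set $E$, with a weight $\omega:V\times V\to\mathbb{R}$ such that $\omega_{xy}=\omega_{yx}\ge 0$ and $\omega_{xy}>0$ if and only if $xy\in E$; connected means that for all $x,y\in V$ there are $x=x_1,\dots,x_m=y$ in $V$ with $\omega_{x_ix_{i+1}}>0$ for $i=1,\dots,m-1$. The measure is a positive function $\mu:V\to(0,\infty)$, $x\mapsto\mu_x$. The Laplace operator is $\Delta u(x)=\frac{1}{\mu_x}\sum_{y\in V}\omega_{xy}(u(y)-u(x))$ for $u:V\to\mathbb{R}$, and $\int_V f\,d\mu=\sum_{x\in V}f(x)\mu_x$. *)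

theory Defs
  imports Complex_Main
begin

(* The vertex set is a finite carrier inside an arbitrary type, and every condition is
   restricted to it: values of weights, measures and functions outside V are irrelevant.
   Edges are unordered pairs; a singleton {x} in E stands for a loop at x (loops are not
   excluded, and contribute nothing to the Laplacian).  Non-emptiness is part of the
   notion of a graph, so that maxima over V make sense. *)
locale connected_finite_weighted_graph =
  fixes V :: "'a set"
    and E :: "'a set set"
    and \<omega> :: "'a \<Rightarrow> 'a \<Rightarrow> real"
    and \<mu> :: "'a \<Rightarrow> real"
  assumes finite_vertices: "finite V"
    and vertices_nonempty: "V \<noteq> {}"
    and edges_subset: "E \<subseteq> {{x, y} | x y. x \<in> V \<and> y \<in> V}"
    and weight_sym: "\<And>x y. x \<in> V \<Longrightarrow> y \<in> V \<Longrightarrow> \<omega> x y = \<omega> y x"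
    and weight_nonneg: "\<And>x y. x \<in> V \<Longrightarrow> y \<in> V \<Longrightarrow> 0 \<le> \<omega> x y"
    and weight_pos_iff: "\<And>x y. x \<in> V \<Longrightarrow> y \<in> V \<Longrightarrow> 0 < \<omega> x y \<longleftrightarrow> {x, y} \<in> E"
    and connected: "\<And>x y. x \<in> V \<Longrightarrow> y \<in> V \<Longrightarrow>
      \<exists>p. p \<noteq> [] \<and> set p \<subseteq> V \<and> hd p = x \<and> last p = y \<and>
          (\<forall>i. Suc i < length p \<longrightarrow> 0 < \<omega> (p ! i) (p ! Suc i))"
    and measure_pos: "\<And>x. x \<in> V \<Longrightarrow> 0 < \<mu> x"

definition graph_laplacian ::
  "'a set \<Rightarrow> ('a \<Rightarrow> 'a \<Rightarrow> real) \<Rightarrow> ('a \<Rightarrow> real) \<Rightarrow> ('a \<Rightarrow> real) \<Rightarrow> 'a \<Rightarrow> real" where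
  "graph_laplacian V \<omega> \<mu> u x = (1 / \<mu> x) * (\<Sum>y\<in>V. \<omega> x y * (u y - u x))"

definition graph_integral ::
  "'a set \<Rightarrow> ('a \<Rightarrow> real) \<Rightarrow> ('a \<Rightarrow> real) \<Rightarrow> real" where
  "graph_integral V \<mu> f = (\<Sum>x\<in>V. f x * \<mu> x)"

definition changes_sign_on :: "'a set \<Rightarrow> ('a \<Rightarrow> real) \<Rightarrow> bool" where
  "changes_sign_on V h \<longleftrightarrow> (\<exists>x\<in>V. 0 < h x) \<and> (\<exists>x\<in>V. h x < 0)"

definition kazdan_warner_solution ::
  "'a set \<Rightarrow> ('a \<Rightarrow> 'a \<Rightarrow> real) \<Rightarrow> ('a \<Rightarrow> real) \<Rightarrow> ('a \<Rightarrow> real) \<Rightarrow> real \<Rightarrow> ('a \<Rightarrow> real) \<Rightarrow> bool" where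
  "kazdan_warner_solution V \<omega> \<mu> h c u \<longleftrightarrow>
     (\<forall>x\<in>V. - graph_laplacian V \<omega> \<mu> u x = h x * exp (u x) - c)"

end

theory Submission
  imports Defs
begin

text \<open>
  Write \<open>M\<close> for the maximum of a solution \<open>u\<close>, and read the equation as
  \<open>outflow u x = \<mu> x * (h x * exp (u x) - c)\<close>, where the outflow of \<open>u\<close> is the unnormalised
  \<open>- \<Delta> u\<close>. Three facts about a connected finite graph carry the proof; all constants below
  depend only on the data, not on \<open>u\<close>.

  \<^item> Nearness to the maximum spreads along edges: a vertex whose outflow is at most \<open>B\<close> and where
    \<open>u\<close> is close to \<open>M\<close> cannot have a neighbour where \<open>u\<close> is far below \<open>M\<close>
    (\<open>near_maximum_spreads\<close>). If the outflow is controlled everywhere, this bounds the oscillation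
    of \<open>u\<close>; if it is controlled only on a set \<open>Z\<close>, it finds a vertex outside \<open>Z\<close> where \<open>u\<close> is
    almost maximal.

  \<^item> The outflow at \<open>x\<close> is at least \<open>- W * (M - u x)\<close>. So where \<open>h\<close> is negative the term
    \<open>\<bar>h\<bar> * exp u\<close> grows at most linearly in \<open>M\<close>.

  \<^item> The outflows sum to zero, that is \<open>(\<Sum>x\<in>V. \<mu> x * h x * exp (u x)) = c * (\<Sum>x\<in>V. \<mu> x)\<close>.

  Upper bound. By the last two facts \<open>\<bar>h\<bar> * exp u\<close> grows at most linearly in \<open>M\<close> at \<^emph>\<open>every\<close>
  vertex. Where \<open>h\<close> vanishes the outflow is the constant \<open>- c * \<mu> x\<close>, so the first fact with
  \<open>Z\<close> the zero set of \<open>h\<close> yields a vertex with \<open>h \<noteq> 0\<close> where \<open>u\<close> is within a constant of \<open>M\<close>.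
  Hence \<open>exp M\<close> is at most linear in \<open>M\<close>, and \<open>M\<close> is bounded (\<open>solutions_bounded_above\<close>).

  Lower bound. With \<open>u\<close> bounded above, the outflow and hence the oscillation of \<open>u\<close> are bounded, so
  it remains to keep \<open>M\<close> from tending to minus infinity. If \<open>c \<noteq> 0\<close>, the integrated equation does
  so at once. If \<open>c = 0\<close>, the oscillation is even \<open>O(exp M)\<close>, so for very negative \<open>M\<close> the function
  \<open>exp (u - M)\<close> would be nearly \<open>1\<close>, and \<open>\<Sum>x\<in>V. \<mu> x * h x * exp (u x - M) = 0\<close> would
  contradict \<open>\<integral> h d\<mu> \<noteq> 0\<close> (\<open>maximum_bounded_below\<close>).
\<close>

context connected_finite_weighted_graph
begin

section \<open>Outflow\<close>

definition outflow :: "('a \<Rightarrow> real) \<Rightarrow> 'a \<Rightarrow> real" where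
  "outflow u x = (\<Sum>y\<in>V. \<omega> x y * (u x - u y))"

definition total_weight :: real where
  "total_weight = (\<Sum>x\<in>V. \<Sum>y\<in>V. \<omega> x y)"

lemma measure_nonneg: "x \<in> V \<Longrightarrow> 0 \<le> \<mu> x"
  using measure_pos by (rule less_imp_le)

lemma measure_le_total_measure: "x \<in> V \<Longrightarrow> \<mu> x \<le> (\<Sum>v\<in>V. \<mu> v)"
  by (rule member_le_sum) (use finite_vertices measure_nonneg in auto)

lemma measure_mult_le_sum:
  assumes "x \<in> V" and "\<And>v. v \<in> V \<Longrightarrow> 0 \<le> f v"
  shows "\<mu> x * f x \<le> (\<Sum>v\<in>V. \<mu> v * f v)"
  by (rule member_le_sum[where f = "\<lambda>v. \<mu> v * f v"])
    (use assms finite_vertices measure_nonneg in \<open>auto intro!: mult_nonneg_nonneg\<close>)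

lemma total_weight_nonneg: "0 \<le> total_weight"
  unfolding total_weight_def by (intro sum_nonneg weight_nonneg)

lemma vertex_weight_le_total_weight:
  assumes "x \<in> V"
  shows "(\<Sum>y\<in>V. \<omega> x y) \<le> total_weight"
  unfolding total_weight_def
  by (rule member_le_sum[where f = "\<lambda>x. \<Sum>y\<in>V. \<omega> x y"])
    (use assms finite_vertices in \<open>auto intro!: sum_nonneg weight_nonneg\<close>)

lemma sum_outflow_eq_0: "(\<Sum>x\<in>V. outflow u x) = 0"
proof -
  have "(\<Sum>x\<in>V. outflow u x) = (\<Sum>y\<in>V. \<Sum>x\<in>V. \<omega> x y * (u x - u y))"
    unfolding outflow_def by (rule sum.swap)
  also have "\<dots> = (\<Sum>y\<in>V. \<Sum>x\<in>V. - (\<omega> y x * (u y - u x)))"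
    by (intro sum.cong refl) (simp add: weight_sym algebra_simps)
  also have "\<dots> = - (\<Sum>x\<in>V. outflow u x)"
    unfolding outflow_def by (simp add: sum_negf)
  finally show ?thesis by simp
qed

lemma outflow_ge:
  assumes "x \<in> V" and "\<And>y. y \<in> V \<Longrightarrow> u y \<le> M"
  shows "- (total_weight * (M - u x)) \<le> outflow u x"
proof -
  have "(\<Sum>y\<in>V. \<omega> x y) * (M - u x) \<le> total_weight * (M - u x)"
    using assms by (intro mult_right_mono vertex_weight_le_total_weight) auto
  moreover have "(\<Sum>y\<in>V. - (\<omega> x y * (M - u x))) \<le> outflow u x"
    unfolding outflow_def
  proof (rule sum_mono)
    fix y assume "y \<in> V"
    then have "\<omega> x y * (u y - u x) \<le> \<omega> x y * (M - u x)"
      using assms by (intro mult_left_mono weight_nonneg) auto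
    then show "- (\<omega> x y * (M - u x)) \<le> \<omega> x y * (u x - u y)"
      by (simp add: algebra_simps)
  qed
  ultimately show ?thesis by (simp add: sum_negf sum_distrib_right)
qed

lemma kazdan_warner_outflow:
  assumes "kazdan_warner_solution V \<omega> \<mu> h c u" and "x \<in> V"
  shows "outflow u x = \<mu> x * (h x * exp (u x) - c)"
proof -
  have "outflow u x = - (\<mu> x * graph_laplacian V \<omega> \<mu> u x)"
    using measure_pos[OF \<open>x \<in> V\<close>]
    by (simp add: outflow_def graph_laplacian_def right_diff_distrib sum_subtractf)
  then show ?thesis
    using assms by (simp add: kazdan_warner_solution_def flip: mult_minus_right)
qed

lemma kazdan_warner_integrated:
  assumes "kazdan_warner_solution V \<omega> \<mu> h c u"
  shows "(\<Sum>x\<in>V. \<mu> x * h x * exp (u x)) = c * (\<Sum>x\<in>V. \<mu> x)"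
proof -
  have "0 = (\<Sum>x\<in>V. outflow u x)"
    by (simp add: sum_outflow_eq_0)
  also have "\<dots> = (\<Sum>x\<in>V. \<mu> x * h x * exp (u x) - c * \<mu> x)"
    by (intro sum.cong refl) (simp add: kazdan_warner_outflow[OF assms] algebra_simps)
  finally show ?thesis
    by (simp add: sum_subtractf sum_distrib_left)
qed

section \<open>Spreading of near-maximality\<close>

lemma connected_induct [consumes 2, case_names start step]:
  assumes "x \<in> V" "y \<in> V" and "P x"
    and step: "\<And>a b. a \<in> V \<Longrightarrow> b \<in> V \<Longrightarrow> 0 < \<omega> a b \<Longrightarrow> P a \<Longrightarrow> P b"
  shows "P y"
proof -
  obtain p where p: "p \<noteq> []" "set p \<subseteq> V" "hd p = x" "last p = y"
    and edge: "\<And>i. Suc i < length p \<Longrightarrow> 0 < \<omega> (p ! i) (p ! Suc i)"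
    using connected[OF assms(1,2)] by metis
  have "i < length p \<Longrightarrow> P (p ! i)" for i
  proof (induction i)
    case 0
    then show ?case using \<open>P x\<close> p by (simp add: hd_conv_nth)
  next
    case (Suc i)
    then have v: "p ! i \<in> V" "p ! Suc i \<in> V" and P: "P (p ! i)"
      using p(2) nth_mem[of i p] nth_mem[of "Suc i" p] by auto
    show ?case
      by (rule step[OF v edge[OF Suc.prems] P])
  qed
  from this[of "length p - 1"] show ?thesis
    using p by (simp add: last_conv_nth)
qed

text \<open>
  A controlled outflow at \<open>a\<close> forces every neighbour of \<open>a\<close> to inherit closeness to the upper
  bound \<open>M\<close>: all other neighbours exceed \<open>u a\<close> by at most \<open>M - u a\<close>, so their total contribution to
  the outflow cannot compensate a deep drop of \<open>u\<close> across one edge.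
\<close>
lemma drop_across_edge:
  assumes a: "a \<in> V" and b: "b \<in> V" and pos: "0 < \<omega> a b"
    and le: "\<And>v. v \<in> V \<Longrightarrow> u v \<le> M" and B: "outflow u a \<le> B"
  shows "\<omega> a b * (M - u b) \<le> total_weight * (M - u a) + B"
proof -
  have "\<omega> a b * (M - u b) \<le> (\<Sum>y\<in>V. \<omega> a y * (M - u y))"
    by (rule member_le_sum[where f = "\<lambda>y. \<omega> a y * (M - u y)"])
      (use a b le finite_vertices in \<open>auto intro!: mult_nonneg_nonneg weight_nonneg\<close>)
  also have "\<dots> = (\<Sum>y\<in>V. \<omega> a y) * (M - u a) + outflow u a"
    unfolding outflow_def sum_distrib_right sum.distrib[symmetric]
    by (intro sum.cong refl) (simp add: algebra_simps)
  also have "(\<Sum>y\<in>V. \<omega> a y) * (M - u a) \<le> total_weight * (M - u a)"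
    using a le by (intro mult_right_mono vertex_weight_le_total_weight) auto
  finally show ?thesis using B by simp
qed

text \<open>
  Iterating the previous estimate along a path from \<open>x\<close> to \<open>y\<close>. The outflow is controlled only on
  \<open>Z\<close>, so it may have to stop where the path leaves \<open>Z\<close>. Letting the conclusion name either \<open>y\<close> or
  some vertex outside \<open>Z\<close> makes the induction go through: once a vertex outside \<open>Z\<close> has been
  found, it serves for all longer paths.
\<close>
lemma near_maximum_spreads_along_path:
  assumes "x \<in> V" and "y \<in> V"
  shows "\<exists>C\<ge>0. \<forall>u B. 0 \<le> B \<longrightarrow> (\<forall>v\<in>V. u v \<le> u x) \<longrightarrow> (\<forall>v\<in>Z. outflow u v \<le> B) \<longrightarrow>
           (\<exists>z\<in>insert y (V - Z). u x - u z \<le> C * B)"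
  using assms
proof (induction rule: connected_induct)
  case start
  show ?case by (rule exI[of _ 0]) auto
next
  case (step a b)
  then obtain C where "0 \<le> C" and C: "\<And>u B. \<lbrakk>0 \<le> B; \<forall>v\<in>V. u v \<le> u x; \<forall>v\<in>Z. outflow u v \<le> B\<rbrakk>
      \<Longrightarrow> \<exists>z\<in>insert a (V - Z). u x - u z \<le> C * B"
    by blast
  define C' where "C' = (total_weight * C + 1) / \<omega> a b"
  have "0 \<le> C'"
    using \<open>0 \<le> C\<close> step(3) total_weight_nonneg by (simp add: C'_def)
  show ?case
  proof (intro exI[of _ "C + C'"] conjI allI impI)
    show "0 \<le> C + C'" using \<open>0 \<le> C\<close> \<open>0 \<le> C'\<close> by simp
    fix u :: "'a \<Rightarrow> real" and B :: real
    assume B: "0 \<le> B" and max: "\<forall>v\<in>V. u v \<le> u x" and out: "\<forall>v\<in>Z. outflow u v \<le> B"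
    obtain z where z: "z \<in> insert a (V - Z)" "u x - u z \<le> C * B"
      using C[OF B max out] by blast
    have ineq: "C * B \<le> (C + C') * B" "C' * B \<le> (C + C') * B"
      using B \<open>0 \<le> C\<close> \<open>0 \<le> C'\<close> by (simp_all add: mult_right_mono)
    show "\<exists>z\<in>insert b (V - Z). u x - u z \<le> (C + C') * B"
    proof (cases "z \<in> Z")
      case False
      then show ?thesis using z ineq(1) step(1) by (intro bexI[of _ z]) auto
    next
      case True
      then have "z = a" using z by auto
      have "\<omega> a b * (u x - u b) \<le> total_weight * (u x - u a) + B"
        using drop_across_edge[OF step(1-3), of u "u x" B] max out True \<open>z = a\<close> by blast
      also have "\<dots> \<le> total_weight * (C * B) + B"
        using z(2) \<open>z = a\<close> total_weight_nonneg by (simp add: mult_left_mono)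
      also have "\<dots> = \<omega> a b * (C' * B)"
        using step(3) by (simp add: C'_def field_simps)
      finally have "u x - u b \<le> C' * B"
        using step(3) by simp
      then show ?thesis using ineq(2) by (intro bexI[of _ b]) auto
    qed
  qed
qed

text \<open>
  With \<open>Z = V\<close> this bounds the oscillation; with \<open>y \<notin> Z\<close> it locates a near-maximum outside \<open>Z\<close>.
  Finiteness of \<open>V\<close> makes the constant independent of the endpoints, which is needed because the
  maximal vertex varies with \<open>u\<close>.
\<close>
lemma near_maximum_spreads:
  "\<exists>C\<ge>0. \<forall>u B. \<forall>x\<in>V. \<forall>y\<in>V. 0 \<le> B \<longrightarrow> (\<forall>v\<in>V. u v \<le> u x) \<longrightarrow>
     (\<forall>v\<in>Z. outflow u v \<le> B) \<longrightarrow> (\<exists>z\<in>insert y (V - Z). u x - u z \<le> C * B)"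
proof -
  define spreads where "spreads C x y \<longleftrightarrow> (\<forall>u B. 0 \<le> B \<longrightarrow> (\<forall>v\<in>V. u v \<le> u x) \<longrightarrow>
     (\<forall>v\<in>Z. outflow u v \<le> B) \<longrightarrow> (\<exists>z\<in>insert y (V - Z). u x - u z \<le> C * B))" for C x y
  have "\<exists>C. 0 \<le> C \<and> spreads C x y" if "x \<in> V" "y \<in> V" for x y
    unfolding spreads_def using that by (rule near_maximum_spreads_along_path)
  then obtain f where "\<And>x y. x \<in> V \<Longrightarrow> y \<in> V \<Longrightarrow> 0 \<le> f x y \<and> spreads (f x y) x y"
    by metis
  then have f0: "\<And>x y. x \<in> V \<Longrightarrow> y \<in> V \<Longrightarrow> 0 \<le> f x y"
    and f: "\<And>x y. x \<in> V \<Longrightarrow> y \<in> V \<Longrightarrow> spreads (f x y) x y"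
    by blast+
  define K where "K = (\<Sum>(x, y)\<in>V \<times> V. f x y)"
  show ?thesis
  proof (intro exI[of _ K] conjI allI ballI impI)
    show "0 \<le> K" unfolding K_def by (intro sum_nonneg) (auto intro: f0)
    fix u :: "'a \<Rightarrow> real" and B x y
    assume *: "x \<in> V" "y \<in> V" "0 \<le> B" "\<forall>v\<in>V. u v \<le> u x" "\<forall>v\<in>Z. outflow u v \<le> B"
    then obtain z where z: "z \<in> insert y (V - Z)" "u x - u z \<le> f x y * B"
      using f[OF *(1,2)] unfolding spreads_def by blast
    have "(\<lambda>(x, y). f x y) (x, y) \<le> K"
      unfolding K_def by (rule member_le_sum) (use * f0 finite_vertices in auto)
    then have "f x y * B \<le> K * B"
      using * by (simp add: mult_right_mono)
    then have "u x - u z \<le> K * B" using z(2) by linarith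
    then show "\<exists>z\<in>insert y (V - Z). u x - u z \<le> K * B"
      using z(1) by (rule bexI)
  qed
qed

lemma exists_maximal_vertex:
  fixes u :: "'a \<Rightarrow> real"
  obtains x where "x \<in> V" and "\<forall>v\<in>V. u v \<le> u x"
proof -
  have "Max (u ` V) \<in> u ` V"
    using finite_vertices vertices_nonempty by simp
  then obtain x where "x \<in> V" "u x = Max (u ` V)" by auto
  then show ?thesis using finite_vertices that by auto
qed

section \<open>Bounds for solutions\<close>

text \<open>
  Where \<open>h\<close> is negative and \<open>u\<close> positive, the equation turns the lower bound for the outflow into one
  for \<open>\<mu> * h * exp u\<close>; where \<open>u \<le> 0\<close> the term is bounded anyway. The integrated equation then
  bounds the same term from above.
\<close>
lemma nonlinearity_at_most_linear:
  "\<exists>A\<ge>0. \<forall>u P. kazdan_warner_solution V \<omega> \<mu> h c u \<longrightarrow> 0 \<le> P \<longrightarrow> (\<forall>v\<in>V. u v \<le> P) \<longrightarrow>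
     (\<forall>x\<in>V. \<bar>\<mu> x * h x * exp (u x)\<bar> \<le> A * (1 + P))"
proof -
  define T where "T = (\<Sum>x\<in>V. \<mu> x)"
  define H where "H = (\<Sum>x\<in>V. \<mu> x * \<bar>h x\<bar>)"
  define A where "A = total_weight + \<bar>c\<bar> * T + H"
  have T: "\<mu> x \<le> T" if "x \<in> V" for x
    unfolding T_def using that by (rule measure_le_total_measure)
  have H: "\<mu> x * \<bar>h x\<bar> \<le> H" if "x \<in> V" for x
    unfolding H_def using that by (intro measure_mult_le_sum) auto
  have "0 \<le> T" "0 \<le> H"
    unfolding T_def H_def by (auto intro!: sum_nonneg mult_nonneg_nonneg measure_nonneg)
  then have cT: "0 \<le> \<bar>c\<bar> * T" by simp
  have "0 \<le> A" using cT \<open>0 \<le> H\<close> total_weight_nonneg by (simp add: A_def)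
  define N where "N = real (card V)"
  have "0 \<le> N" by (simp add: N_def)
  show ?thesis
  proof (intro exI[of _ "\<bar>c\<bar> * T + (N + 1) * A"] conjI allI ballI impI)
    show "0 \<le> \<bar>c\<bar> * T + (N + 1) * A" using cT \<open>0 \<le> A\<close> \<open>0 \<le> N\<close> by simp
    fix u P x
    assume sol: "kazdan_warner_solution V \<omega> \<mu> h c u" and P: "0 \<le> P" and le: "\<forall>v\<in>V. u v \<le> P"
      and x: "x \<in> V"
    define g where "g v = \<mu> v * h v * exp (u v)" for v
    have "0 \<le> A * (1 + P)" using \<open>0 \<le> A\<close> P by simp
    have lower: "- (A * (1 + P)) \<le> g v" if v: "v \<in> V" for v
    proof (cases "u v \<le> 0")
      case True
      have "\<bar>g v\<bar> \<le> \<mu> v * \<bar>h v\<bar> * 1"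
        unfolding g_def abs_mult using measure_pos[OF v] True
        by (intro mult_mono) auto
      also have "\<dots> \<le> A"
        using H[OF v] cT total_weight_nonneg by (simp add: A_def)
      also have "\<dots> \<le> A * (1 + P)"
        using \<open>0 \<le> A\<close> P by (simp add: algebra_simps)
      finally show ?thesis by simp
    next
      case False
      have "total_weight * (P - u v) \<le> total_weight * P"
        using False total_weight_nonneg by (simp add: mult_left_mono)
      moreover have "- (total_weight * (P - u v)) \<le> g v - \<mu> v * c"
        using outflow_ge[OF v, of u P] le kazdan_warner_outflow[OF sol v]
        by (simp add: g_def algebra_simps)
      moreover have "- (\<bar>c\<bar> * T) \<le> \<mu> v * c"
      proof -
        have "\<bar>\<mu> v * c\<bar> \<le> T * \<bar>c\<bar>"
          unfolding abs_mult using measure_pos[OF v] T[OF v] by (intro mult_mono) auto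
        then show ?thesis by (simp add: mult.commute)
      qed
      moreover have "total_weight * P + \<bar>c\<bar> * T \<le> A * (1 + P)"
      proof -
        have "0 \<le> total_weight + \<bar>c\<bar> * T * P + H * (1 + P)"
          using total_weight_nonneg cT \<open>0 \<le> H\<close> P by simp
        then show ?thesis by (simp add: A_def algebra_simps)
      qed
      ultimately show ?thesis by linarith
    qed
    have "c * T = sum g V"
      using kazdan_warner_integrated[OF sol] by (simp add: g_def T_def)
    also have "\<dots> = g x + sum g (V - {x})"
      using x finite_vertices by (simp add: sum.remove)
    finally have eq: "g x = c * T - sum g (V - {x})" by simp
    have "- sum g (V - {x}) \<le> (\<Sum>v\<in>V - {x}. A * (1 + P))"
      unfolding sum_negf[symmetric] using lower by (intro sum_mono) (force simp: minus_le_iff)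
    also have "\<dots> \<le> (\<Sum>v\<in>V. A * (1 + P))"
      using finite_vertices \<open>0 \<le> A * (1 + P)\<close> by (intro sum_mono2) auto
    finally have "- sum g (V - {x}) \<le> N * (A * (1 + P))" by (simp add: N_def)
    moreover have "c * T \<le> \<bar>c\<bar> * T" using \<open>0 \<le> T\<close> by (simp add: mult_right_mono)
    ultimately have "g x \<le> \<bar>c\<bar> * T + N * (A * (1 + P))" using eq by linarith
    moreover have "0 \<le> N * (A * (1 + P))" "0 \<le> \<bar>c\<bar> * T * P"
      using \<open>0 \<le> N\<close> \<open>0 \<le> A * (1 + P)\<close> cT P by simp_all
    moreover have "(\<bar>c\<bar> * T + (N + 1) * A) * (1 + P)
        = \<bar>c\<bar> * T + \<bar>c\<bar> * T * P + N * (A * (1 + P)) + A * (1 + P)"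
      by (simp add: algebra_simps)
    ultimately have "\<bar>g x\<bar> \<le> (\<bar>c\<bar> * T + (N + 1) * A) * (1 + P)"
      using lower[OF x] \<open>0 \<le> A * (1 + P)\<close> cT unfolding abs_le_iff by linarith
    then show "\<bar>\<mu> x * h x * exp (u x)\<bar> \<le> (\<bar>c\<bar> * T + (N + 1) * A) * (1 + P)"
      by (simp add: g_def)
  qed
qed

lemma exp_at_most_linear_imp_bounded:
  fixes M K :: real
  assumes "exp M \<le> K * (1 + max M 0)" and "0 \<le> K"
  shows "M \<le> 2 * K + 2"
proof (rule ccontr)
  assume "\<not> ?thesis"
  then have M: "2 * K + 2 < M" by simp
  have "1 + M + M\<^sup>2 / 2 \<le> exp M"
    using M assms(2) by (intro exp_lower_Taylor_quadratic) simp
  moreover have "(2 * K + 2) * M \<le> M\<^sup>2"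
    unfolding power2_eq_square using M assms(2) by (intro mult_right_mono) auto
  ultimately show False
    using M assms by (simp add: algebra_simps)
qed

text \<open>
  The near-maximum outside the zero set of \<open>h\<close> makes the growth estimate for
  \<open>\<mu> * h * exp u\<close> apply to \<open>exp M\<close>, up to the factor \<open>exp (C * B)\<close> lost on the way to that vertex
  and the reciprocal of \<open>\<mu> * \<bar>h\<bar>\<close> there, uniformly bounded by the sum \<open>r\<close>.
\<close>
lemma solutions_bounded_above:
  assumes "\<exists>x\<in>V. h x \<noteq> 0"
  shows "\<exists>K. \<forall>u. kazdan_warner_solution V \<omega> \<mu> h c u \<longrightarrow> (\<forall>x\<in>V. u x \<le> K)"
proof -
  obtain a where a: "a \<in> V" "h a \<noteq> 0" using assms by blast
  define Z where "Z = {x \<in> V. h x = 0}"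
  define S where "S = V - Z"
  define T where "T = (\<Sum>x\<in>V. \<mu> x)"
  define B where "B = \<bar>c\<bar> * T"
  have T: "\<mu> x \<le> T" if "x \<in> V" for x
    unfolding T_def using that by (rule measure_le_total_measure)
  have "0 \<le> T" using T[OF a(1)] measure_pos[OF a(1)] by simp
  then have "0 \<le> B" by (simp add: B_def)
  obtain C where C: "\<And>u B x. \<lbrakk>x \<in> V; 0 \<le> B; \<forall>v\<in>V. u v \<le> u x; \<forall>v\<in>Z. outflow u v \<le> B\<rbrakk>
      \<Longrightarrow> \<exists>z\<in>S. u x - u z \<le> C * B"
  proof -
    have "insert a (V - Z) = S" using a by (auto simp: S_def Z_def)
    then show thesis using near_maximum_spreads[of Z] a(1) that by metis
  qed
  obtain A where "0 \<le> A" and A: "\<And>u P x. \<lbrakk>kazdan_warner_solution V \<omega> \<mu> h c u; 0 \<le> P;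
      \<forall>v\<in>V. u v \<le> P; x \<in> V\<rbrakk> \<Longrightarrow> \<bar>\<mu> x * h x * exp (u x)\<bar> \<le> A * (1 + P)"
    using nonlinearity_at_most_linear[of h c] by blast
  define r where "r = (\<Sum>z\<in>S. 1 / (\<mu> z * \<bar>h z\<bar>))"
  have S: "0 < \<mu> z * \<bar>h z\<bar>" "z \<in> V" if "z \<in> S" for z
    using that measure_pos by (auto simp: S_def Z_def)
  have r: "1 / (\<mu> z * \<bar>h z\<bar>) \<le> r" if "z \<in> S" for z
    unfolding r_def
    by (rule member_le_sum[where f = "\<lambda>z. 1 / (\<mu> z * \<bar>h z\<bar>)"])
      (use that S finite_vertices in \<open>auto simp: S_def intro!: less_imp_le\<close>)
  have "0 \<le> r"
    unfolding r_def using S by (intro sum_nonneg) (simp add: less_imp_le)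
  define K where "K = exp (C * B) * (r * A)"
  have "0 \<le> K" using \<open>0 \<le> r\<close> \<open>0 \<le> A\<close> by (simp add: K_def)
  show ?thesis
  proof (intro exI[of _ "2 * K + 2"] allI impI ballI)
    fix u y assume sol: "kazdan_warner_solution V \<omega> \<mu> h c u" and y: "y \<in> V"
    obtain x where x: "x \<in> V" "\<forall>v\<in>V. u v \<le> u x" by (rule exists_maximal_vertex)
    have "outflow u v \<le> B" if "v \<in> Z" for v
    proof -
      have v: "v \<in> V" "h v = 0" using that by (auto simp: Z_def)
      have "\<bar>\<mu> v * c\<bar> \<le> T * \<bar>c\<bar>"
        unfolding abs_mult using measure_pos[OF v(1)] T[OF v(1)] by (intro mult_mono) auto
      then show ?thesis
        using kazdan_warner_outflow[OF sol v(1)] v(2) by (simp add: B_def mult.commute)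
    qed
    then obtain z where z: "z \<in> S" "u x - u z \<le> C * B"
      using C[OF x(1) \<open>0 \<le> B\<close> x(2)] by blast
    let ?P = "max (u x) 0"
    have g: "\<mu> z * \<bar>h z\<bar> * exp (u z) \<le> A * (1 + ?P)"
      using A[OF sol, of ?P z] x S[OF z(1)] measure_pos[of z] by (force simp: abs_mult)
    have "exp (u z) = 1 / (\<mu> z * \<bar>h z\<bar>) * (\<mu> z * \<bar>h z\<bar> * exp (u z))"
      using S(1)[OF z(1)] by (auto simp: zero_less_mult_iff)
    also have "\<dots> \<le> r * (A * (1 + ?P))"
      by (rule mult_mono[OF r[OF z(1)] g \<open>0 \<le> r\<close>]) (use S(1)[OF z(1)] in simp)
    finally have ez: "exp (u z) \<le> r * (A * (1 + ?P))" .
    have "exp (u x) \<le> exp (C * B + u z)" using z(2) by simp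
    also have "\<dots> \<le> exp (C * B) * (r * (A * (1 + ?P)))"
      unfolding exp_add using ez by simp
    finally have "exp (u x) \<le> K * (1 + ?P)" by (simp add: K_def mult.assoc)
    then have "u x \<le> 2 * K + 2"
      using \<open>0 \<le> K\<close> by (rule exp_at_most_linear_imp_bounded)
    then show "u y \<le> 2 * K + 2" using x(2) y by force
  qed
qed

text \<open>
  The oscillation estimate is kept in a form that is sharp for very negative solutions: for
  \<open>c = 0\<close> it has to tend to zero with \<open>exp M\<close>.
\<close>
lemma solution_oscillation:
  "\<exists>C\<ge>0. \<forall>u x y. kazdan_warner_solution V \<omega> \<mu> h c u \<longrightarrow> x \<in> V \<longrightarrow> y \<in> V \<longrightarrow>
     (\<forall>v\<in>V. u v \<le> u x) \<longrightarrow> u x - u y \<le> C * (exp (u x) + \<bar>c\<bar>)"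
proof -
  define D where "D = (\<Sum>v\<in>V. \<mu> v * (\<bar>h v\<bar> + 1))"
  have D: "\<mu> v * (\<bar>h v\<bar> + 1) \<le> D" if "v \<in> V" for v
    unfolding D_def using that by (intro measure_mult_le_sum) auto
  have "0 \<le> D"
    unfolding D_def by (auto intro!: sum_nonneg mult_nonneg_nonneg measure_nonneg)
  obtain C where "0 \<le> C" and C: "\<And>u B x y. \<lbrakk>x \<in> V; y \<in> V; 0 \<le> B; \<forall>v\<in>V. u v \<le> u x;
      \<forall>v\<in>V. outflow u v \<le> B\<rbrakk> \<Longrightarrow> u x - u y \<le> C * B"
    using near_maximum_spreads[of V] by auto
  show ?thesis
  proof (intro exI[of _ "C * D"] conjI allI impI)
    show "0 \<le> C * D" using \<open>0 \<le> C\<close> \<open>0 \<le> D\<close> by simp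
    fix u x y
    assume sol: "kazdan_warner_solution V \<omega> \<mu> h c u" and xy: "x \<in> V" "y \<in> V"
      and max: "\<forall>v\<in>V. u v \<le> u x"
    have "outflow u v \<le> D * (exp (u x) + \<bar>c\<bar>)" if v: "v \<in> V" for v
    proof -
      have "h v * exp (u v) \<le> \<bar>h v\<bar> * exp (u x)"
        using max v by (intro mult_mono) auto
      moreover have "- c \<le> \<bar>c\<bar>" and "0 \<le> \<bar>h v\<bar> * \<bar>c\<bar>" and "0 \<le> exp (u x)" by simp_all
      ultimately have "h v * exp (u v) - c \<le> (\<bar>h v\<bar> + 1) * (exp (u x) + \<bar>c\<bar>)"
        unfolding distrib_left distrib_right by linarith
      then have "outflow u v \<le> \<mu> v * ((\<bar>h v\<bar> + 1) * (exp (u x) + \<bar>c\<bar>))"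
        unfolding kazdan_warner_outflow[OF sol v]
        using measure_pos[OF v] by (simp add: mult_left_mono)
      also have "\<dots> \<le> D * (exp (u x) + \<bar>c\<bar>)"
        unfolding mult.assoc[symmetric] using D[OF v] by (intro mult_right_mono) auto
      finally show ?thesis .
    qed
    then have "u x - u y \<le> C * (D * (exp (u x) + \<bar>c\<bar>))"
      using xy max \<open>0 \<le> D\<close> by (intro C) auto
    then show "u x - u y \<le> C * D * (exp (u x) + \<bar>c\<bar>)" by (simp add: mult.assoc)
  qed
qed

text \<open>
  The integrated equation bounds \<open>exp M\<close> from below by a multiple of \<open>\<bar>c\<bar>\<close>. For \<open>c = 0\<close> the
  normalised function \<open>exp (u - M)\<close> integrates to zero against \<open>h\<close> but differs from \<open>1\<close> by at most
  the oscillation of \<open>u\<close>, so \<open>\<bar>\<integral> h d\<mu>\<bar>\<close> is bounded by a multiple of \<open>exp M\<close>.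
\<close>
lemma maximum_bounded_below:
  assumes "c \<noteq> 0 \<or> graph_integral V \<mu> h \<noteq> 0"
  shows "\<exists>L. \<forall>u x. kazdan_warner_solution V \<omega> \<mu> h c u \<longrightarrow> x \<in> V \<longrightarrow>
     (\<forall>v\<in>V. u v \<le> u x) \<longrightarrow> L \<le> u x"
proof -
  define H where "H = (\<Sum>v\<in>V. \<mu> v * \<bar>h v\<bar>)"
  have mult_H: "\<bar>\<Sum>v\<in>V. \<mu> v * h v * f v\<bar> \<le> H * t" if "\<And>v. v \<in> V \<Longrightarrow> \<bar>f v\<bar> \<le> t" for f t
  proof -
    have "\<bar>\<Sum>v\<in>V. \<mu> v * h v * f v\<bar> \<le> (\<Sum>v\<in>V. \<mu> v * \<bar>h v\<bar> * t)"
    proof (rule order_trans[OF sum_abs sum_mono])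
      fix v assume "v \<in> V"
      then show "\<bar>\<mu> v * h v * f v\<bar> \<le> \<mu> v * \<bar>h v\<bar> * t"
        using that measure_pos[of v] unfolding abs_mult by (intro mult_mono) auto
    qed
    then show ?thesis by (simp add: H_def sum_distrib_right)
  qed
  have "\<exists>\<delta>>0. \<exists>R. \<forall>u x. kazdan_warner_solution V \<omega> \<mu> h c u \<longrightarrow> x \<in> V \<longrightarrow>
     (\<forall>v\<in>V. u v \<le> u x) \<longrightarrow> \<delta> \<le> R * exp (u x)"
  proof (cases "c = 0")
    case False
    have "0 < (\<Sum>v\<in>V. \<mu> v)"
      using finite_vertices vertices_nonempty measure_pos by (intro sum_pos) auto
    show ?thesis
    proof (rule exI[of _ "\<bar>c\<bar> * (\<Sum>v\<in>V. \<mu> v)"], intro conjI exI[of _ H] allI impI)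
      show "0 < \<bar>c\<bar> * (\<Sum>v\<in>V. \<mu> v)" using False \<open>0 < (\<Sum>v\<in>V. \<mu> v)\<close> by simp
      fix u x
      assume sol: "kazdan_warner_solution V \<omega> \<mu> h c u" and max: "\<forall>v\<in>V. u v \<le> u x"
      have "\<bar>\<Sum>v\<in>V. \<mu> v * h v * exp (u v)\<bar> \<le> H * exp (u x)"
        using max by (intro mult_H) auto
      then show "\<bar>c\<bar> * (\<Sum>v\<in>V. \<mu> v) \<le> H * exp (u x)"
        using kazdan_warner_integrated[OF sol] \<open>0 < (\<Sum>v\<in>V. \<mu> v)\<close> by (simp add: abs_mult)
    qed
  next
    case True
    obtain C where C: "\<And>u x y. \<lbrakk>kazdan_warner_solution V \<omega> \<mu> h c u; x \<in> V; y \<in> V;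
        \<forall>v\<in>V. u v \<le> u x\<rbrakk> \<Longrightarrow> u x - u y \<le> C * exp (u x)"
      using solution_oscillation[of h c] unfolding True abs_zero add_0_right by blast
    show ?thesis
    proof (rule exI[of _ "\<bar>graph_integral V \<mu> h\<bar>"], intro conjI exI[of _ "H * C"] allI impI)
      show "0 < \<bar>graph_integral V \<mu> h\<bar>" using assms True by simp
      fix u x
      assume sol: "kazdan_warner_solution V \<omega> \<mu> h c u" and x: "x \<in> V"
        and max: "\<forall>v\<in>V. u v \<le> u x"
      have "(\<Sum>v\<in>V. \<mu> v * h v * exp (u v - u x)) = (\<Sum>v\<in>V. \<mu> v * h v * exp (u v)) / exp (u x)"
        by (simp add: exp_diff sum_divide_distrib)
      then have "(\<Sum>v\<in>V. \<mu> v * h v * exp (u v - u x)) = 0"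
        using kazdan_warner_integrated[OF sol] True by simp
      then have "graph_integral V \<mu> h = (\<Sum>v\<in>V. \<mu> v * h v * (1 - exp (u v - u x)))"
        by (simp add: graph_integral_def right_diff_distrib sum_subtractf mult.commute)
      moreover have "\<bar>\<Sum>v\<in>V. \<mu> v * h v * (1 - exp (u v - u x))\<bar> \<le> H * (C * exp (u x))"
      proof (rule mult_H)
        fix v assume v: "v \<in> V"
        have "1 + (u v - u x) \<le> exp (u v - u x)" by (rule exp_ge_add_one_self)
        moreover have "exp (u v - u x) \<le> 1" using max v by simp
        ultimately show "\<bar>1 - exp (u v - u x)\<bar> \<le> C * exp (u x)"
          using C[OF sol x v max] by linarith
      qed
      ultimately show "\<bar>graph_integral V \<mu> h\<bar> \<le> H * C * exp (u x)" by (simp add: mult.assoc)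
    qed
  qed
  then obtain \<delta> R where "0 < \<delta>" and R: "\<And>u x. \<lbrakk>kazdan_warner_solution V \<omega> \<mu> h c u; x \<in> V;
      \<forall>v\<in>V. u v \<le> u x\<rbrakk> \<Longrightarrow> \<delta> \<le> R * exp (u x)"
    by blast
  show ?thesis
  proof (intro exI[of _ "ln (\<delta> / R)"] allI impI)
    fix u x
    assume "kazdan_warner_solution V \<omega> \<mu> h c u" "x \<in> V" "\<forall>v\<in>V. u v \<le> u x"
    then have le: "\<delta> \<le> R * exp (u x)" by (rule R)
    then have "0 < R * exp (u x)" using \<open>0 < \<delta>\<close> by linarith
    then have "0 < R" by (simp add: zero_less_mult_iff)
    then have "\<delta> / R \<le> exp (u x)" using le by (simp add: field_simps)
    then have "ln (\<delta> / R) \<le> ln (exp (u x))"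
      using \<open>0 < \<delta>\<close> \<open>0 < R\<close> by (intro ln_mono) auto
    then show "ln (\<delta> / R) \<le> u x" by simp
  qed
qed

text \<open>
  This form shows what the sign conditions on \<open>h\<close> are used for: they keep \<open>h\<close> from vanishing
  identically and, for \<open>c = 0\<close>, its integral from being zero.
\<close>
theorem solutions_uniformly_bounded:
  assumes "\<exists>x\<in>V. h x \<noteq> 0" and "c \<noteq> 0 \<or> graph_integral V \<mu> h \<noteq> 0"
  shows "\<exists>C. \<forall>u. kazdan_warner_solution V \<omega> \<mu> h c u \<longrightarrow> (\<forall>x\<in>V. \<bar>u x\<bar> \<le> C)"
proof -
  obtain K where K: "\<And>u x. kazdan_warner_solution V \<omega> \<mu> h c u \<Longrightarrow> x \<in> V \<Longrightarrow> u x \<le> K"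
    using solutions_bounded_above[OF assms(1), of c] by blast
  obtain L where L: "\<And>u x. \<lbrakk>kazdan_warner_solution V \<omega> \<mu> h c u; x \<in> V; \<forall>v\<in>V. u v \<le> u x\<rbrakk>
      \<Longrightarrow> L \<le> u x"
    using maximum_bounded_below[OF assms(2)] by blast
  obtain C where "0 \<le> C" and C: "\<And>u x y. \<lbrakk>kazdan_warner_solution V \<omega> \<mu> h c u; x \<in> V; y \<in> V;
      \<forall>v\<in>V. u v \<le> u x\<rbrakk> \<Longrightarrow> u x - u y \<le> C * (exp (u x) + \<bar>c\<bar>)"
    using solution_oscillation[of h c] by blast
  show ?thesis
  proof (intro exI[of _ "\<bar>K\<bar> + \<bar>L\<bar> + C * (exp K + \<bar>c\<bar>)"] allI impI ballI)
    fix u y assume sol: "kazdan_warner_solution V \<omega> \<mu> h c u" and y: "y \<in> V"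
    obtain x where x: "x \<in> V" "\<forall>v\<in>V. u v \<le> u x" by (rule exists_maximal_vertex)
    have "C * (exp (u x) + \<bar>c\<bar>) \<le> C * (exp K + \<bar>c\<bar>)"
      using \<open>0 \<le> C\<close> K[OF sol x(1)] by (intro mult_left_mono) auto
    moreover have "0 \<le> C * (exp K + \<bar>c\<bar>)" using \<open>0 \<le> C\<close> by simp
    ultimately show "\<bar>u y\<bar> \<le> \<bar>K\<bar> + \<bar>L\<bar> + C * (exp K + \<bar>c\<bar>)"
      using C[OF sol x(1) y x(2)] L[OF sol x] K[OF sol y] by linarith
  qed
qed

end

theorem theorem2p1:
  fixes V :: "'a set"
    and E :: "'a set set"
    and \<omega> :: "'a \<Rightarrow> 'a \<Rightarrow> real"
    and \<mu> :: "'a \<Rightarrow> real"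
    and h :: "'a \<Rightarrow> real"
    and c :: real
  assumes "connected_finite_weighted_graph V E \<omega> \<mu>"
    and "c > 0 \<Longrightarrow> \<exists>x\<in>V. h x > 0"
    and "c = 0 \<Longrightarrow> changes_sign_on V h \<and> graph_integral V \<mu> h < 0"
    and "c < 0 \<Longrightarrow> \<exists>x\<in>V. h x < 0"
  shows "\<exists>C::real. \<forall>u :: 'a \<Rightarrow> real.
           kazdan_warner_solution V \<omega> \<mu> h c u \<longrightarrow> Max ((\<lambda>x. \<bar>u x\<bar>) ` V) \<le> C"
proof -
  interpret connected_finite_weighted_graph V E \<omega> \<mu> by (rule assms(1))
  have "\<exists>x\<in>V. h x \<noteq> 0"
  proof (cases c "0 :: real" rule: linorder_cases)
    case less
    then show ?thesis using assms(4) by force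
  next
    case equal
    then show ?thesis using assms(3) by (force simp: changes_sign_on_def)
  next
    case greater
    then show ?thesis using assms(2) by force
  qed
  moreover have "c \<noteq> 0 \<or> graph_integral V \<mu> h \<noteq> 0"
    using assms(3) by force
  ultimately obtain C where
    "\<And>u x. kazdan_warner_solution V \<omega> \<mu> h c u \<Longrightarrow> x \<in> V \<Longrightarrow> \<bar>u x\<bar> \<le> C"
    using solutions_uniformly_bounded by blast
  then show ?thesis
    using finite_vertices vertices_nonempty by (intro exI[of _ C]) simp
qed

end
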